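(* Let $M=G/H$ be a reductive homogeneous manifold of dimension $3$ with an equivariant spin structure, and let $\Phi=[\tilde A,\varphi]\in\mathcal N^G$ be a $G$-invariant universal spinor field of unit length on $M$. Then $$\mathcal E(\Phi)=\frac{1}{32\det(A)}\sum_{i=1}^3\bigl(c_{i12}^2(A)+c_{i13}^2(A)+c_{i23}^2(A)\bigr),$$ and consequently $Q_2(\Phi)=0$. Hence the solution of the homogeneous spinor flow on $M$ with initial value $\Phi$ is of the form $I\ni t\mapsto[\tilde A_t,\varphi]\in\mathcal N^G$ for a horizontal curve $I\ni t\mapsto\tilde A_t\in\widetilde{\mathrm{GL}}_+(3)$ with $\tilde A_0=\tilde A$; and the same holds for the solution of the volume-normalized homogeneous spinor flow if $\Phi\in\mathcal N_1^G$.
   Context: Standing assumptions: $G$ is a connected, simply connected Lie group acting transitively and orientation-preservingly on an oriented $n$-manifold $M$ (here $n=3$); $x\in M$ is fixed with stabilizer $H$, so $M\cong G/H$; $H$ is compact; $\mathfrak g=\mathfrak h\oplus\mathfrak p$ with $\mathfrak p$ $\mathrm{Ad}(H)$-invariant; $T_xM\cong\mathfrak p$; subscript $\mathfrak p$ denotes projection along $\mathfrak h$. A $G$-invariant background metric $\bar g$ is fixed (of unit volume if $M$ is compact), with oriented $\bar g$-orthonormal basis $(X_1,\dots,X_n)$ of $\mathfrak p$, identifying $\mathfrak p\cong\mathbb R^n$; $\alpha:H\to\mathrm{SO}(n)\subset \mathrm{GL}_+(n)$ is the isotropy representation and $\tilde\alpha:H\to\widetilde{\mathrm{GL}}_+(n)$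 a lift of it (an equivariant spin structure). $\widetilde{\mathrm{GL}}_+(n)\to\mathrm{GL}_+(n)$ is the connected double cover; $A$ denotes the image of $\tilde A$; $\mathrm{Spin}(n)$ is the preimage of $\mathrm{SO}(n)$; $\rho_n$ is the spin representation on $\Sigma_n=\mathbb C^{2^{\lfloor n/2\rfloor}}$, with $\langle\cdot,\cdot\rangle$ the real part of the invariant Hermitian product (for which Clifford multiplication by unit vectors is isometric); $E_i$ is the standard basis of $\mathbb R^n$. $F_n=\widetilde{\mathrm{GL}}_+(n)\times_{\rho_n}\Sigma_n$, with $[\tilde A\tilde b,\varphi]=[\tilde A,\rho_n(\tilde b)\varphi]$. $\mathcal F^G$ is the set of $[\tilde A,\varphi]\in F_n$ fixed by $h\cdot[\tilde A,\varphi]=[\tilde\alpha(h)\tilde A,\varphi]$, $h\in H$ (these are the $G$-invariant universal spinor fields, i.e. $G$-invariant pairs of a metric and a spinor field); $\mathcal N^G=\{[\tilde A,\varphi]\in\mathcal F^G:|\varphi|=1\}$ and $\mathcal N^G_1=\{[\tilde A,\varphi]\in\mathcal N^G:\det A=1\}$. The metric of $[\tilde A,\varphi]$ is $g=A^{-T}A^{-1}\in \mathrm{Sym}_+(n,\mathbb R)^H$ (positive definite symmetric matrices that are $H$-invariant as bilinear forms). A curve $A_t$ in $\mathrm{GL}_+(n)$, or a curve $\tilde A_t$ covering it, is horizontal if $A_t^{-1}\dot A_t$ is symmetric for all $t$; it is a horizontal lift of $g_t$ if moreover $g_t=A_t^{-T}A_t^{-1}$. With $$c_{ijk}(A)=\bar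 g(A^{-1}[AX_i,AX_k]_{\mathfrak p},X_j)+\bar g(A^{-1}[AX_j,AX_k]_{\mathfrak p},X_i)-\bar g(A^{-1}[AX_i,AX_j]_{\mathfrak p},X_k),$$ the spinorial energy of $\Phi=[\tilde A,\varphi]$ is given by $$\mathcal E(\Phi)=\frac{1}{32\det(A)}\sum_i\Bigl|\sum_{j<k}c_{ijk}(A)E_j\cdot E_k\cdot\varphi\Bigr|^2$$ (for $M$ compact this equals $\frac12\int_M|\nabla^g\varphi|^2\mathrm{vol}_g$; for $M$ non-compact it is the definition). For $\Phi=[\tilde A,\varphi]\in\mathcal N^G$ with metric $g$, $H$ acts on $\Sigma_n$ via $\rho_n(\tilde A^{-1}\tilde\alpha(\cdot)\tilde A)$, and $Q(\Phi)=(Q_1(\Phi),Q_2(\Phi))\in \mathrm{Sym}(n,\mathbb R)^H\times(\varphi^\perp)^H$ is determined by $$\mathrm{tr}(Q_1(\Phi)g^{-1}\dot g g^{-1})=-\det(A)\tfrac{d}{dt}\big|_{t=0}\mathcal E([\tilde A_t,\varphi]),\qquad \langle Q_2(\Phi),\dot\varphi\rangle=-\det(A)\tfrac{d}{dt}\big|_{t=0}\mathcal E([\tilde A,\varphi+t\dot\varphi]),$$ for all $\dot g\in\mathrm{Sym}(n,\mathbb R)^H$ and $\dot\varphi\in(\varphi^\perp)^H$, where $\tilde A_t$ is the horizontal lift with $\tilde A_0=\tilde A$ of a path $g_t$ in $\mathrm{Sym}_+(n,\mathbb R)^H$ with $g_0=g$, $\dot g_0=\dot g$. The homogeneous spinor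 flow is the ODE $(\dot g_t,\dot\varphi_t)=(Q_1(\Phi_t),Q_2(\Phi_t))$, where $\Phi_t=[\tilde A_t,\varphi_t]$ and $\tilde A_t$ is the horizontal lift of $g_t$ (with $\tilde A_0=\tilde A$). The volume-normalized homogeneous spinor flow on $\mathcal N_1^G$ is the ODE obtained by replacing $Q$ by $\tilde Q$, where $\tilde Q_1(\Phi)=Q_1(\Phi)+\frac{n-2}{2n}\mathcal E(\Phi)\,g$ and $\tilde Q_2(\Phi)=Q_2(\Phi)$. *)

theory Defs
  imports "HOL-Analysis.Analysis" "HOL-Algebra.Group_Action"
begin

section \<open>Smooth manifolds\<close>

text \<open>
  A manifold is a whole type together with an atlas; a chart is a pair of an open set and a
  coordinate map that is only meaningful on that set. \<open>Ck_on\<close> is used on open sets only.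
\<close>

primrec Ck_on :: "nat \<Rightarrow> 'a::euclidean_space set \<Rightarrow> ('a \<Rightarrow> 'b::real_normed_vector) \<Rightarrow> bool" where
  "Ck_on 0 S f \<longleftrightarrow> continuous_on S f"
| "Ck_on (Suc k) S f \<longleftrightarrow>
     (\<forall>x\<in>S. f differentiable (at x)) \<and> (\<forall>v. Ck_on k S (\<lambda>x. frechet_derivative f (at x) v))"

definition smooth_on :: "'a::euclidean_space set \<Rightarrow> ('a \<Rightarrow> 'b::real_normed_vector) \<Rightarrow> bool" where
  "smooth_on S f \<longleftrightarrow> (\<forall>k. Ck_on k S f)"

type_synonym ('a, 'e) chart = "'a set \<times> ('a \<Rightarrow> 'e)"

definition smooth_map ::
  "('a::topological_space, 'e::euclidean_space) chart set \<Rightarrow>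
   ('b::topological_space, 'f::euclidean_space) chart set \<Rightarrow> ('a \<Rightarrow> 'b) \<Rightarrow> bool" where
  "smooth_map \<A> \<B> f \<longleftrightarrow> continuous_on UNIV f \<and>
     (\<forall>(U, \<kappa>)\<in>\<A>. \<forall>(V, \<tau>)\<in>\<B>. smooth_on (\<kappa> ` (U \<inter> f -` V)) (\<tau> \<circ> f \<circ> inv_into U \<kappa>))"

definition smooth_atlas :: "('a::topological_space, 'e::euclidean_space) chart set \<Rightarrow> bool" where
  "smooth_atlas \<A> \<longleftrightarrow>
     (\<Union>(U, \<kappa>)\<in>\<A>. U) = UNIV \<and>
     (\<forall>(U, \<kappa>)\<in>\<A>. open U \<and> open (\<kappa> ` U) \<and> (\<exists>\<iota>. homeomorphism U (\<kappa> ` U) \<kappa> \<iota>)) \<and>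
     smooth_map \<A> \<A> id"

definition prod_atlas ::
  "('a, 'e) chart set \<Rightarrow> ('b, 'f) chart set \<Rightarrow> ('a \<times> 'b, 'e \<times> 'f) chart set" where
  "prod_atlas \<A> \<B> = {(U \<times> V, map_prod \<kappa> \<tau>) | U V \<kappa> \<tau>. (U, \<kappa>) \<in> \<A> \<and> (V, \<tau>) \<in> \<B>}"

definition smooth_funs :: "('a, 'e::euclidean_space) chart set \<Rightarrow> ('a \<Rightarrow> real) set" where
  "smooth_funs \<A> = {f. \<forall>(U, \<kappa>)\<in>\<A>. smooth_on (\<kappa> ` U) (f \<circ> inv_into U \<kappa>)}"

text \<open>For \<open>f = id\<close>: the atlas is oriented.\<close>

definition orientation_preserving :: "('a, real^'n) chart set \<Rightarrow> ('a \<Rightarrow> 'a) \<Rightarrow> bool" where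
  "orientation_preserving \<A> f \<longleftrightarrow>
     (\<forall>(U, \<kappa>)\<in>\<A>. \<forall>(V, \<tau>)\<in>\<A>. \<forall>z\<in>\<kappa> ` (U \<inter> f -` V).
        det (matrix (frechet_derivative (\<tau> \<circ> f \<circ> inv_into U \<kappa>) (at z))) > 0)"

subsection \<open>Tangent vectors and Riemannian metrics\<close>

text \<open>
  Tangent vectors are point derivations of the algebra of smooth functions, made unique as HOL
  functions by the value 0 on functions that are not smooth.
\<close>

type_synonym 'a tvec = "('a \<Rightarrow> real) \<Rightarrow> real"

definition tangent_space :: "('a, 'e::euclidean_space) chart set \<Rightarrow> 'a \<Rightarrow> 'a tvec set" where
  "tangent_space \<A> y = {\<xi>.
     (\<forall>f\<in>smooth_funs \<A>. \<forall>g\<in>smooth_funs \<A>.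
        (\<forall>a b. \<xi> (\<lambda>z. a * f z + b * g z) = a * \<xi> f + b * \<xi> g) \<and>
        \<xi> (\<lambda>z. f z * g z) = \<xi> f * g y + f y * \<xi> g) \<and>
     (\<forall>f. f \<notin> smooth_funs \<A> \<longrightarrow> \<xi> f = 0)}"

definition coord_vec ::
  "('a, 'e::euclidean_space) chart set \<Rightarrow> ('a, 'e) chart \<Rightarrow> 'a \<Rightarrow> 'e \<Rightarrow> 'a tvec" where
  "coord_vec \<A> c y v = (\<lambda>f. if f \<in> smooth_funs \<A>
     then frechet_derivative (f \<circ> inv_into (fst c) (snd c)) (at (snd c y)) v else 0)"

definition positively_oriented :: "('a, real^'n) chart set \<Rightarrow> 'a \<Rightarrow> ('n \<Rightarrow> 'a tvec) \<Rightarrow> bool" where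
  "positively_oriented \<A> y \<xi> \<longleftrightarrow>
     (\<forall>(U, \<kappa>)\<in>\<A>. y \<in> U \<longrightarrow>
        (\<exists>B :: real^'n^'n. (\<forall>j. \<xi> j = coord_vec \<A> (U, \<kappa>) y (column j B)) \<and> det B > 0))"

type_synonym 'a metric_field = "'a \<Rightarrow> 'a tvec \<Rightarrow> 'a tvec \<Rightarrow> real"

definition riemannian_metric ::
  "('a, 'e::euclidean_space) chart set \<Rightarrow> 'a metric_field \<Rightarrow> bool" where
  "riemannian_metric \<A> m \<longleftrightarrow>
     (\<forall>y. \<forall>\<xi>\<in>tangent_space \<A> y. \<forall>\<eta>\<in>tangent_space \<A> y.
        m y \<xi> \<eta> = m y \<eta> \<xi> \<and>
        (\<forall>\<zeta>\<in>tangent_space \<A> y. \<forall>a b. m y (\<lambda>f. a * \<xi> f + b * \<eta> f) \<zeta> = a * m y \<xi> \<zeta> + b * m y \<eta> \<zeta>) \<and>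
        (\<xi> \<noteq> (\<lambda>f. 0) \<longrightarrow> m y \<xi> \<xi> > 0)) \<and>
     (\<forall>(U, \<kappa>)\<in>\<A>. \<forall>u v. smooth_on (\<kappa> ` U)
        ((\<lambda>y. m y (coord_vec \<A> (U, \<kappa>) y u) (coord_vec \<A> (U, \<kappa>) y v)) \<circ> inv_into U \<kappa>))"

definition gram_matrix ::
  "('a, real^'n) chart set \<Rightarrow> 'a metric_field \<Rightarrow> ('a, real^'n) chart \<Rightarrow> 'a \<Rightarrow> real^'n^'n" where
  "gram_matrix \<A> m c y =
     (\<chi> i j. m y (coord_vec \<A> c y (axis i 1)) (coord_vec \<A> c y (axis j 1)))"

definition riemannian_volume ::
  "('a::topological_space, real^'n) chart set \<Rightarrow> 'a metric_field \<Rightarrow> 'a measure \<Rightarrow> bool" where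
  "riemannian_volume \<A> m \<mu> \<longleftrightarrow> sets \<mu> = sets borel \<and>
     (\<forall>(U, \<kappa>)\<in>\<A>. \<forall>B\<in>sets borel. B \<subseteq> U \<longrightarrow>
        emeasure \<mu> B =
          (\<integral>\<^sup>+z\<in>\<kappa> ` B. ennreal (sqrt (det (gram_matrix \<A> m (U, \<kappa>) (inv_into U \<kappa> z)))) \<partial>lborel))"

section \<open>Lie groups and their Lie algebras\<close>

definition lie_group ::
  "'g::{t2_space,second_countable_topology} monoid \<Rightarrow> ('g, 'e::euclidean_space) chart set \<Rightarrow> bool" where
  "lie_group G \<A> \<longleftrightarrow> group G \<and> carrier G = UNIV \<and> smooth_atlas \<A> \<and>
     smooth_map (prod_atlas \<A> \<A>) \<A> (\<lambda>(a, b). a \<otimes>\<^bsub>G\<^esub> b) \<and>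
     smooth_map \<A> \<A> (\<lambda>a. inv\<^bsub>G\<^esub> a)"

text \<open>
  The Lie algebra consists of the left-invariant vector fields, i.e. of the left-invariant
  derivations of the algebra of smooth functions (again 0 on functions that are not smooth).
  The vector space operations on it are pointwise.
\<close>

type_synonym 'g vfield = "('g \<Rightarrow> real) \<Rightarrow> 'g \<Rightarrow> real"

definition lie_algebra :: "'g monoid \<Rightarrow> ('g, 'e::euclidean_space) chart set \<Rightarrow> 'g vfield set" where
  "lie_algebra G \<A> = {X.
     (\<forall>f\<in>smooth_funs \<A>. X f \<in> smooth_funs \<A> \<and>
        (\<forall>a. X (\<lambda>b. f (a \<otimes>\<^bsub>G\<^esub> b)) = (\<lambda>b. X f (a \<otimes>\<^bsub>G\<^esub> b))) \<and>
        (\<forall>g\<in>smooth_funs \<A>.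
           (\<forall>r s. X (\<lambda>z. r * f z + s * g z) = (\<lambda>z. r * X f z + s * X g z)) \<and>
           X (\<lambda>z. f z * g z) = (\<lambda>z. X f z * g z + f z * X g z))) \<and>
     (\<forall>f. f \<notin> smooth_funs \<A> \<longrightarrow> X f = (\<lambda>z. 0))}"

definition lie_bracket :: "'g vfield \<Rightarrow> 'g vfield \<Rightarrow> 'g vfield" where
  "lie_bracket X Y = (\<lambda>f z. X (Y f) z - Y (X f) z)"

text \<open>The differential of the conjugation \<open>b \<mapsto> h b h\<inverse>\<close>, as push-forward of vector fields.\<close>

definition Ad :: "'g monoid \<Rightarrow> 'g \<Rightarrow> 'g vfield \<Rightarrow> 'g vfield" where
  "Ad G h X = (\<lambda>f a. X (\<lambda>b. f (h \<otimes>\<^bsub>G\<^esub> b \<otimes>\<^bsub>G\<^esub> inv\<^bsub>G\<^esub> h)) (inv\<^bsub>G\<^esub> h \<otimes>\<^bsub>G\<^esub> a \<otimes>\<^bsub>G\<^esub> h))"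

text \<open>\<open>c\<close> is the one-parameter group \<open>t \<mapsto> exp (t X)\<close>.\<close>

definition subgroup_lie_algebra ::
  "'g monoid \<Rightarrow> ('g, 'e::euclidean_space) chart set \<Rightarrow> 'g set \<Rightarrow> 'g vfield set" where
  "subgroup_lie_algebra G \<A> H = {X \<in> lie_algebra G \<A>. \<exists>c :: real \<Rightarrow> 'g.
     (\<forall>s t. c (s + t) = c s \<otimes>\<^bsub>G\<^esub> c t) \<and>
     (\<forall>f\<in>smooth_funs \<A>. \<forall>t. ((\<lambda>s. f (c s)) has_real_derivative X f (c t)) (at t)) \<and>
     range c \<subseteq> H}"

definition vf_subspace :: "'g vfield set \<Rightarrow> bool" where
  "vf_subspace S \<longleftrightarrow> (\<lambda>f z. 0) \<in> S \<and>
     (\<forall>X\<in>S. \<forall>Y\<in>S. \<forall>r s. (\<lambda>f z. r * X f z + s * Y f z) \<in> S)"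

section \<open>The double cover of the orientation-preserving linear group and the spin representation\<close>

text \<open>
  The connected double cover is unique only up to isomorphism, so it is treated as any topological
  group \<open>L\<close> with a suitable projection \<open>p\<close>.
\<close>

definition connected_double_cover :: "'l::topological_space monoid \<Rightarrow> ('l \<Rightarrow> real^'n^'n) \<Rightarrow> bool" where
  "connected_double_cover L p \<longleftrightarrow> group L \<and> carrier L = UNIV \<and>
     continuous_on UNIV (\<lambda>(a, b). a \<otimes>\<^bsub>L\<^esub> b) \<and> continuous_on UNIV (\<lambda>a. inv\<^bsub>L\<^esub> a) \<and>
     connected (UNIV :: 'l set) \<and>
     covering_space UNIV p {A. det A > 0} \<and>
     (\<forall>a b. p (a \<otimes>\<^bsub>L\<^esub> b) = p a ** p b) \<and>
     (\<forall>A. det A > 0 \<longrightarrow> card {a. p a = A} = 2)"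

text \<open>
  Clifford multiplication on the spinor module of dimension 2. The real inner product of the library
  on \<^typ>\<open>complex^2\<close> is the real part of the standard Hermitian product, and unit vectors are
  required to act isometrically. No choice is made between the two inequivalent Clifford modules;
  they induce the same representation of the spin group.
\<close>

definition clifford_mult :: "(real^3 \<Rightarrow> complex^2^2) \<Rightarrow> bool" where
  "clifford_mult \<gamma> \<longleftrightarrow> linear \<gamma> \<and>
     (\<forall>v w. \<gamma> v ** \<gamma> w + \<gamma> w ** \<gamma> v = mat (complex_of_real (- 2 * (v \<bullet> w)))) \<and>
     (\<forall>v \<psi>. norm v = 1 \<longrightarrow> norm (\<gamma> v *v \<psi>) = norm \<psi>)"

inductive_set clifford_spin :: "(real^3 \<Rightarrow> complex^2^2) \<Rightarrow> (complex^2^2) set"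
  for \<gamma> :: "real^3 \<Rightarrow> complex^2^2" where
  one: "mat 1 \<in> clifford_spin \<gamma>"
| step: "\<lbrakk>s \<in> clifford_spin \<gamma>; norm v = 1; norm w = 1\<rbrakk> \<Longrightarrow> \<gamma> v ** \<gamma> w ** s \<in> clifford_spin \<gamma>"

definition spin :: "('l \<Rightarrow> real^'n^'n) \<Rightarrow> 'l set" where
  "spin p = {b. rotation_matrix (p b)}"

text \<open>
  The spin representation is the isomorphism of the preimage of the rotation group with the group of
  even products of unit vectors in the Clifford algebra (acting on spinors) that is compatible with
  the two projections to the rotation group. It is unique: two such isomorphisms differ by a
  continuous character with values \<open>\<plusminus>1\<close> on a connected group.
\<close>

definition spin_representation ::
  "'l::topological_space monoid \<Rightarrow> ('l \<Rightarrow> real^3^3) \<Rightarrow> (real^3 \<Rightarrow> complex^2^2) \<Rightarrow>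
   ('l \<Rightarrow> complex^2^2) \<Rightarrow> bool" where
  "spin_representation L p \<gamma> \<rho> \<longleftrightarrow>
     bij_betw \<rho> (spin p) (clifford_spin \<gamma>) \<and> continuous_on (spin p) \<rho> \<and>
     (\<forall>a\<in>spin p. \<forall>b\<in>spin p. \<rho> (a \<otimes>\<^bsub>L\<^esub> b) = \<rho> a ** \<rho> b) \<and>
     (\<forall>b\<in>spin p. \<forall>v. \<gamma> (p b *v v) ** \<rho> b = \<rho> b ** \<gamma> v)"

section \<open>Homogeneous 3-manifolds with an equivariant spin structure\<close>

type_synonym spinor = "complex^2"

record ('g, 'e, 'm, 'l) homogeneous =
  grp :: "'g monoid"
  grp_atlas :: "('g, 'e) chart set"
  mfd_atlas :: "('m, real^3) chart set"
  act :: "'g \<Rightarrow> 'm \<Rightarrow> 'm"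
  base_point :: 'm
  compl_p :: "'g vfield set"
  bg_metric :: "'m metric_field"
  frame :: "3 \<Rightarrow> 'g vfield"
  cover_grp :: "'l monoid"
  cover :: "'l \<Rightarrow> real^3^3"
  cliff :: "real^3 \<Rightarrow> complex^2^2"
  spin_rep :: "'l \<Rightarrow> complex^2^2"
  iso_lift :: "'g \<Rightarrow> 'l"

definition isotropy :: "('g, 'e, 'm, 'l) homogeneous \<Rightarrow> 'g set" where
  "isotropy D = stabilizer (grp D) (act D) (base_point D)"

definition isotropy_alg :: "('g, 'e::euclidean_space, 'm, 'l) homogeneous \<Rightarrow> 'g vfield set" where
  "isotropy_alg D = subgroup_lie_algebra (grp D) (grp_atlas D) (isotropy D)"

text \<open>
  The map \<open>X \<mapsto> d/dt exp (t X) \<cdot> x\<close> at \<open>t = 0\<close>, where \<open>x\<close> is the base point; it identifies \<open>\<pp>\<close> with the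
  tangent space at \<open>x\<close>, and thereby defines the inner product \<open>ip\<close> on \<open>\<pp>\<close>.
\<close>

definition orbit_vec :: "('g, 'e, 'm, 'l) homogeneous \<Rightarrow> 'g vfield \<Rightarrow> 'm tvec" where
  "orbit_vec D X = (\<lambda>f. if f \<in> smooth_funs (mfd_atlas D)
     then X (\<lambda>a. f (act D a (base_point D))) \<one>\<^bsub>grp D\<^esub> else 0)"

definition ip :: "('g, 'e, 'm, 'l) homogeneous \<Rightarrow> 'g vfield \<Rightarrow> 'g vfield \<Rightarrow> real" where
  "ip D X Y = bg_metric D (base_point D) (orbit_vec D X) (orbit_vec D Y)"

definition proj_p :: "('g, 'e::euclidean_space, 'm, 'l) homogeneous \<Rightarrow> 'g vfield \<Rightarrow> 'g vfield" where
  "proj_p D Z = (THE P. P \<in> compl_p D \<and> (\<exists>W\<in>isotropy_alg D. Z = (\<lambda>f z. P f z + W f z)))"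

text \<open>Matrices act on \<open>\<pp>\<close> through the identification with \<open>\<real>\<^sup>3\<close> given by the frame.\<close>

definition mat_act :: "('g, 'e, 'm, 'l) homogeneous \<Rightarrow> real^3^3 \<Rightarrow> 'g vfield \<Rightarrow> 'g vfield" where
  "mat_act D A Y = (\<lambda>f z. \<Sum>i\<in>UNIV. (A *v (\<chi> k. ip D Y (frame D k))) $ i * frame D i f z)"

text \<open>
  The isotropy representation as a matrix: under the identification of the tangent space with \<open>\<pp>\<close>
  the differential of \<open>h\<close> at the base point is \<open>Ad h\<close> on \<open>\<pp>\<close>.
\<close>

definition iso_rep :: "('g, 'e, 'm, 'l) homogeneous \<Rightarrow> 'g \<Rightarrow> real^3^3" where
  "iso_rep D h = (\<chi> i j. ip D (Ad (grp D) h (frame D j)) (frame D i))"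

definition homogeneous_manifold ::
  "('g::{t2_space,second_countable_topology}, 'e::euclidean_space,
    'm::{t2_space,second_countable_topology}, 'l) homogeneous \<Rightarrow> bool" where
  "homogeneous_manifold D \<longleftrightarrow>
     lie_group (grp D) (grp_atlas D) \<and>
     connected (UNIV :: 'g set) \<and> simply_connected (UNIV :: 'g set) \<and>
     smooth_atlas (mfd_atlas D) \<and> orientation_preserving (mfd_atlas D) id \<and>
     transitive_action (grp D) (UNIV :: 'm set) (act D) \<and>
     smooth_map (prod_atlas (grp_atlas D) (mfd_atlas D)) (mfd_atlas D) (\<lambda>(a, y). act D a y) \<and>
     (\<forall>a. orientation_preserving (mfd_atlas D) (act D a)) \<and>
     compact (isotropy D)"

definition reductive_complement ::
  "('g, 'e::euclidean_space, 'm, 'l) homogeneous \<Rightarrow> bool" where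
  "reductive_complement D \<longleftrightarrow>
     compl_p D \<subseteq> lie_algebra (grp D) (grp_atlas D) \<and> vf_subspace (compl_p D) \<and>
     compl_p D \<inter> isotropy_alg D = {\<lambda>f z. 0} \<and>
     (\<forall>Z\<in>lie_algebra (grp D) (grp_atlas D).
        \<exists>W\<in>isotropy_alg D. \<exists>P\<in>compl_p D. Z = (\<lambda>f z. W f z + P f z)) \<and>
     (\<forall>h\<in>isotropy D. \<forall>P\<in>compl_p D. Ad (grp D) h P \<in> compl_p D)"

definition background_metric ::
  "('g, 'e, 'm::topological_space, 'l) homogeneous \<Rightarrow> bool" where
  "background_metric D \<longleftrightarrow>
     riemannian_metric (mfd_atlas D) (bg_metric D) \<and>
     (\<forall>a y. \<forall>\<xi>\<in>tangent_space (mfd_atlas D) y. \<forall>\<eta>\<in>tangent_space (mfd_atlas D) y.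
        bg_metric D (act D a y) (\<lambda>f. \<xi> (f \<circ> act D a)) (\<lambda>f. \<eta> (f \<circ> act D a)) =
        bg_metric D y \<xi> \<eta>) \<and>
     (compact (UNIV :: 'm set) \<longrightarrow>
        (\<exists>\<mu>. riemannian_volume (mfd_atlas D) (bg_metric D) \<mu> \<and> emeasure \<mu> UNIV = 1))"

definition oriented_orthonormal_frame :: "('g, 'e, 'm, 'l) homogeneous \<Rightarrow> bool" where
  "oriented_orthonormal_frame D \<longleftrightarrow>
     range (frame D) \<subseteq> compl_p D \<and>
     (\<forall>i j. ip D (frame D i) (frame D j) = (if i = j then 1 else 0)) \<and>
     (\<forall>P\<in>compl_p D. P = (\<lambda>f z. \<Sum>i\<in>UNIV. ip D P (frame D i) * frame D i f z)) \<and>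
     positively_oriented (mfd_atlas D) (base_point D) (\<lambda>i. orbit_vec D (frame D i))"

definition equivariant_spin_structure ::
  "('g::topological_space, 'e, 'm, 'l::topological_space) homogeneous \<Rightarrow> bool" where
  "equivariant_spin_structure D \<longleftrightarrow>
     connected_double_cover (cover_grp D) (cover D) \<and>
     clifford_mult (cliff D) \<and>
     spin_representation (cover_grp D) (cover D) (cliff D) (spin_rep D) \<and>
     continuous_on (isotropy D) (iso_lift D) \<and>
     (\<forall>h\<in>isotropy D. \<forall>k\<in>isotropy D.
        iso_lift D (h \<otimes>\<^bsub>grp D\<^esub> k) = iso_lift D h \<otimes>\<^bsub>cover_grp D\<^esub> iso_lift D k) \<and>
     (\<forall>h\<in>isotropy D. cover D (iso_lift D h) = iso_rep D h)"

definition reductive_homogeneous_spin_manifold ::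
  "('g::{t2_space,second_countable_topology}, 'e::euclidean_space,
    'm::{t2_space,second_countable_topology}, 'l::topological_space) homogeneous \<Rightarrow> bool" where
  "reductive_homogeneous_spin_manifold D \<longleftrightarrow>
     homogeneous_manifold D \<and> reductive_complement D \<and> background_metric D \<and>
     oriented_orthonormal_frame D \<and> equivariant_spin_structure D"

section \<open>Invariant universal spinor fields\<close>

text \<open>
  Elements of the associated bundle are equivalence classes of pairs, with
  \<open>[a b, \<psi>] = [a, \<rho> b \<psi>]\<close> for \<open>b\<close> in the spin group.
\<close>

definition uspinor :: "('g, 'e, 'm, 'l) homogeneous \<Rightarrow> 'l \<Rightarrow> spinor \<Rightarrow> ('l \<times> spinor) set" where
  "uspinor D a \<phi> = {(a \<otimes>\<^bsub>cover_grp D\<^esub> b, \<psi>) | b \<psi>. b \<in> spin (cover D) \<and> spin_rep D b *v \<psi> = \<phi>}"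

definition F_inv :: "('g, 'e, 'm, 'l) homogeneous \<Rightarrow> ('l \<times> spinor) set set" where
  "F_inv D = {uspinor D a \<phi> | a \<phi>.
     \<forall>h\<in>isotropy D. uspinor D (iso_lift D h \<otimes>\<^bsub>cover_grp D\<^esub> a) \<phi> = uspinor D a \<phi>}"

definition N_inv :: "('g, 'e, 'm, 'l) homogeneous \<Rightarrow> ('l \<times> spinor) set set" where
  "N_inv D = {uspinor D a \<phi> | a \<phi>. uspinor D a \<phi> \<in> F_inv D \<and> norm \<phi> = 1}"

definition N1_inv :: "('g, 'e, 'm, 'l) homogeneous \<Rightarrow> ('l \<times> spinor) set set" where
  "N1_inv D = {uspinor D a \<phi> | a \<phi>. uspinor D a \<phi> \<in> N_inv D \<and> det (cover D a) = 1}"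

definition metric_of :: "real^3^3 \<Rightarrow> real^3^3" where
  "metric_of A = transpose (matrix_inv A) ** matrix_inv A"

definition Sym_inv :: "('g, 'e, 'm, 'l) homogeneous \<Rightarrow> (real^3^3) set" where
  "Sym_inv D = {B. transpose B = B \<and>
     (\<forall>h\<in>isotropy D. transpose (iso_rep D h) ** B ** iso_rep D h = B)}"

definition Sym_pos_inv :: "('g, 'e, 'm, 'l) homogeneous \<Rightarrow> (real^3^3) set" where
  "Sym_pos_inv D = {B \<in> Sym_inv D. \<forall>v. v \<noteq> 0 \<longrightarrow> v \<bullet> (B *v v) > 0}"

text \<open>Curves are parametrised by an interval \<open>I\<close>, with one-sided derivatives at end points in \<open>I\<close>.\<close>

definition horizontal_curve ::
  "('g, 'e, 'm, 'l::topological_space) homogeneous \<Rightarrow> real set \<Rightarrow> (real \<Rightarrow> 'l) \<Rightarrow> bool" where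
  "horizontal_curve D I a \<longleftrightarrow> continuous_on I a \<and>
     (\<exists>A'. \<forall>t\<in>I. ((\<lambda>s. cover D (a s)) has_vector_derivative A' t) (at t within I) \<and>
        transpose (matrix_inv (cover D (a t)) ** A' t) = matrix_inv (cover D (a t)) ** A' t)"

definition horizontal_lift ::
  "('g, 'e, 'm, 'l::topological_space) homogeneous \<Rightarrow> real set \<Rightarrow> (real \<Rightarrow> real^3^3) \<Rightarrow>
   (real \<Rightarrow> 'l) \<Rightarrow> bool" where
  "horizontal_lift D I g a \<longleftrightarrow> horizontal_curve D I a \<and> (\<forall>t\<in>I. g t = metric_of (cover D (a t)))"

section \<open>Spinorial energy and the homogeneous spinor flow\<close>

definition struct_c ::
  "('g, 'e::euclidean_space, 'm, 'l) homogeneous \<Rightarrow> 3 \<Rightarrow> 3 \<Rightarrow> 3 \<Rightarrow> real^3^3 \<Rightarrow> real" where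
  "struct_c D i j k A =
     (let X = frame D;
          br = (\<lambda>i k. mat_act D (matrix_inv A)
                  (proj_p D (lie_bracket (mat_act D A (X i)) (mat_act D A (X k)))))
      in ip D (br i k) (X j) + ip D (br j k) (X i) - ip D (br i j) (X k))"

text \<open>
  The index pairs \<open>j < k\<close> are listed explicitly because \<open>3 = 0\<close> is the least element of the type \<open>3\<close>.
\<close>

definition energy ::
  "('g, 'e::euclidean_space, 'm, 'l) homogeneous \<Rightarrow> 'l \<Rightarrow> spinor \<Rightarrow> real" where
  "energy D a \<phi> =
     (let A = cover D a; E = (\<lambda>j. cliff D (axis j 1)) in
      1 / (32 * det A) *
        (\<Sum>i\<in>UNIV. (norm (\<Sum>(j, k)\<in>{(1, 2), (1, 3), (2, 3)}.
           struct_c D i j k A *\<^sub>R (E j *v (E k *v \<phi>))))\<^sup>2))"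

text \<open>
  \<open>(\<phi>\<^sup>\<bottom>)\<^sup>H\<close>, where \<open>h\<close> acts on spinors through \<open>a\<inverse> \<alpha>(h) a\<close>, with \<open>\<alpha>\<close> the lifted isotropy representation;
  this element lies in the spin group if the class of \<open>(a, \<phi>)\<close> is invariant.
\<close>

definition perp_inv ::
  "('g, 'e, 'm, 'l) homogeneous \<Rightarrow> 'l \<Rightarrow> spinor \<Rightarrow> spinor set" where
  "perp_inv D a \<phi> = {\<psi>. \<phi> \<bullet> \<psi> = 0 \<and>
     (\<forall>h\<in>isotropy D.
        spin_rep D (inv\<^bsub>cover_grp D\<^esub> a \<otimes>\<^bsub>cover_grp D\<^esub> iso_lift D h \<otimes>\<^bsub>cover_grp D\<^esub> a) *v \<psi> = \<psi>)}"

definition Q1 ::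
  "('g, 'e::euclidean_space, 'm, 'l::topological_space) homogeneous \<Rightarrow> 'l \<Rightarrow> spinor \<Rightarrow> real^3^3" where
  "Q1 D a \<phi> = (THE q. q \<in> Sym_inv D \<and>
     (\<forall>g' \<in> Sym_inv D. \<forall>\<epsilon>>0. \<forall>g a'.
        (\<forall>t\<in>{-\<epsilon><..<\<epsilon>}. g t \<in> Sym_pos_inv D) \<and>
        g 0 = metric_of (cover D a) \<and> (g has_vector_derivative g') (at 0) \<and>
        horizontal_lift D {-\<epsilon><..<\<epsilon>} g a' \<and> a' 0 = a \<longrightarrow>
        trace (q ** matrix_inv (g 0) ** g' ** matrix_inv (g 0)) =
          - det (cover D a) * deriv (\<lambda>t. energy D (a' t) \<phi>) 0))"

definition Q2 ::
  "('g, 'e::euclidean_space, 'm, 'l) homogeneous \<Rightarrow> 'l \<Rightarrow> spinor \<Rightarrow> spinor" where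
  "Q2 D a \<phi> = (THE q. q \<in> perp_inv D a \<phi> \<and>
     (\<forall>\<phi>' \<in> perp_inv D a \<phi>.
        q \<bullet> \<phi>' = - det (cover D a) * deriv (\<lambda>t. energy D a (\<phi> + t *\<^sub>R \<phi>')) 0))"

text \<open>The volume normalisation, with coefficient \<open>(n - 2) / (2 n)\<close> for \<open>n = 3\<close>.\<close>

definition Q1_norm ::
  "('g, 'e::euclidean_space, 'm, 'l::topological_space) homogeneous \<Rightarrow> 'l \<Rightarrow> spinor \<Rightarrow> real^3^3" where
  "Q1_norm D a \<phi> = Q1 D a \<phi> + ((3 - 2) / (2 * 3) * energy D a \<phi>) *\<^sub>R metric_of (cover D a)"

definition Q2_norm ::
  "('g, 'e::euclidean_space, 'm, 'l) homogeneous \<Rightarrow> 'l \<Rightarrow> spinor \<Rightarrow> spinor" where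
  "Q2_norm D a \<phi> = Q2 D a \<phi>"

text \<open>
  \<open>\<Phi>\<close> is a solution on the interval \<open>I\<close>, inside the set \<open>\<W>\<close> of universal spinor fields, of the ODE for
  pairs of a metric and a spinor with right-hand side \<open>(R1, R2)\<close> and initial representative \<open>(a, \<phi>)\<close>.
\<close>

definition flow_solution ::
  "('g, 'e, 'm, 'l::topological_space) homogeneous \<Rightarrow> ('l \<times> spinor) set set \<Rightarrow>
   ('l \<Rightarrow> spinor \<Rightarrow> real^3^3) \<Rightarrow> ('l \<Rightarrow> spinor \<Rightarrow> spinor) \<Rightarrow>
   real set \<Rightarrow> 'l \<Rightarrow> spinor \<Rightarrow> (real \<Rightarrow> ('l \<times> spinor) set) \<Rightarrow> bool" where
  "flow_solution D \<W> R1 R2 I a \<phi> \<Phi> \<longleftrightarrow> is_interval I \<and> 0 \<in> I \<and>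
     (\<exists>g a' \<phi>'. a' 0 = a \<and> \<phi>' 0 = \<phi> \<and> horizontal_lift D I g a' \<and>
        (\<forall>t\<in>I. g t \<in> Sym_pos_inv D \<and> \<Phi> t = uspinor D (a' t) (\<phi>' t) \<and> \<Phi> t \<in> \<W> \<and>
           (g has_vector_derivative R1 (a' t) (\<phi>' t)) (at t within I) \<and>
           (\<phi>' has_vector_derivative R2 (a' t) (\<phi>' t)) (at t within I)))"

definition spinor_flow_solution ::
  "('g, 'e::euclidean_space, 'm, 'l::topological_space) homogeneous \<Rightarrow> real set \<Rightarrow> 'l \<Rightarrow> spinor \<Rightarrow>
   (real \<Rightarrow> ('l \<times> spinor) set) \<Rightarrow> bool" where
  "spinor_flow_solution D = flow_solution D (N_inv D) (Q1 D) (Q2 D)"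

definition normalized_flow_solution ::
  "('g, 'e::euclidean_space, 'm, 'l::topological_space) homogeneous \<Rightarrow> real set \<Rightarrow> 'l \<Rightarrow> spinor \<Rightarrow>
   (real \<Rightarrow> ('l \<times> spinor) set) \<Rightarrow> bool" where
  "normalized_flow_solution D = flow_solution D (N1_inv D) (Q1_norm D) (Q2_norm D)"

end

theory Submission
  imports Defs
begin

text \<open>
  Clifford multiplication by a vector \<open>v\<close> scales the length of every spinor by \<open>norm v\<close>. Polarising
  this in \<open>v\<close> for a fixed spinor \<open>\<psi>\<close> shows that orthogonal vectors send \<open>\<psi>\<close> to orthogonal spinors. In
  dimension 3 any two of the index pairs \<open>12\<close>, \<open>13\<close>, \<open>23\<close> share an index; after the Clifford relation
  has moved the shared vector to the front, it cancels from the inner product. Hence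
  \<open>E\<^sub>1E\<^sub>2\<psi>\<close>, \<open>E\<^sub>1E\<^sub>3\<psi>\<close>, \<open>E\<^sub>2E\<^sub>3\<psi>\<close> are pairwise orthogonal of length \<open>norm \<psi>\<close>, so the energy of
  \<open>(a, \<psi>)\<close> is a number depending on \<open>a\<close> alone times \<open>(norm \<psi>)\<^sup>2\<close> (\<open>energy_eq\<close>). (In higher dimensions
  disjoint index pairs such as \<open>12\<close>, \<open>34\<close> occur, and the argument breaks down.)

  On a unit spinor \<open>\<phi>\<close> this is the asserted formula. Moving \<open>\<phi>\<close> in a direction orthogonal to it changes
  \<open>(norm \<phi>)\<^sup>2\<close> only to second order, so the spinor component of the negative gradient vanishes
  (\<open>Q2_eq_0\<close>). Along a flow line the spinor therefore has zero derivative and stays constant on the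
  interval, while the horizontal lift of the metrics provides the required curve
  (\<open>flow_solution_constant_spinor\<close>). The volume normalisation modifies only the metric component of
  the vector field, so the same argument applies to it.
\<close>

section \<open>Clifford multiplication and inner products\<close>

lemma matrix_vector_mult_scaleR_right:
  fixes M :: "complex^'n^'m"
  shows "M *v (r *\<^sub>R \<psi>) = r *\<^sub>R (M *v \<psi>)"
  by (simp add: vec_eq_iff matrix_vector_mult_def scaleR_sum_right)

lemma matrix_vector_mult_scaleR_left:
  fixes M :: "complex^'n^'m"
  shows "(r *\<^sub>R M) *v \<psi> = r *\<^sub>R (M *v \<psi>)"
  by (simp add: vec_eq_iff matrix_vector_mult_def scaleR_sum_right)

lemma norm_clifford_mult:
  assumes "clifford_mult \<gamma>"
  shows "norm (\<gamma> v *v \<psi>) = norm v * norm \<psi>"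
proof (cases "v = 0")
  case True
  then show ?thesis using assms by (simp add: clifford_mult_def linear_0)
next
  case False
  let ?u = "(1 / norm v) *\<^sub>R v"
  have "\<gamma> v = norm v *\<^sub>R \<gamma> ?u"
    using assms False by (simp add: clifford_mult_def linear_scale)
  moreover have "norm (\<gamma> ?u *v \<psi>) = norm \<psi>"
    using assms False by (simp add: clifford_mult_def)
  ultimately show ?thesis by (simp add: matrix_vector_mult_scaleR_left)
qed

text \<open>Polarisation of the preceding identity in the vector.\<close>

lemma inner_clifford_mult_vectors:
  assumes "clifford_mult \<gamma>"
  shows "(\<gamma> v *v \<psi>) \<bullet> (\<gamma> w *v \<psi>) = (v \<bullet> w) * (norm \<psi>)\<^sup>2"
proof -
  have add: "\<gamma> v *v \<psi> + \<gamma> w *v \<psi> = \<gamma> (v + w) *v \<psi>"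
    using assms by (simp add: clifford_mult_def linear_add matrix_vector_mult_add_rdistrib)
  show ?thesis
    unfolding dot_norm add norm_clifford_mult[OF assms] by (simp add: field_simps power_mult_distrib)
qed

text \<open>Polarisation in the spinor.\<close>

lemma inner_clifford_mult_spinors:
  assumes "clifford_mult \<gamma>"
  shows "(\<gamma> v *v \<psi>) \<bullet> (\<gamma> v *v \<eta>) = (norm v)\<^sup>2 * (\<psi> \<bullet> \<eta>)"
proof -
  have add: "\<gamma> v *v \<psi> + \<gamma> v *v \<eta> = \<gamma> v *v (\<psi> + \<eta>)"
    by (simp add: matrix_vector_right_distrib)
  show ?thesis
    unfolding dot_norm add norm_clifford_mult[OF assms] by (simp add: field_simps power_mult_distrib)
qed

lemma clifford_mult_anticommute:
  assumes "clifford_mult \<gamma>" and "v \<bullet> w = 0"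
  shows "\<gamma> v *v (\<gamma> w *v \<psi>) = - (\<gamma> w *v (\<gamma> v *v \<psi>))"
proof -
  have "\<gamma> v ** \<gamma> w + \<gamma> w ** \<gamma> v = 0"
    using assms by (simp add: clifford_mult_def)
  then have "(\<gamma> v ** \<gamma> w + \<gamma> w ** \<gamma> v) *v \<psi> = 0" by simp
  then show ?thesis
    by (simp add: matrix_vector_mult_add_rdistrib matrix_vector_mul_assoc eq_neg_iff_add_eq_0)
qed

text \<open>
  The three products of two distinct vectors of an orthonormal triple send a spinor to an orthogonal
  triple: each two of these products share a factor, which can be commuted to the left and cancelled.
\<close>

lemma norm_clifford_two_vectors:
  assumes \<gamma>: "clifford_mult \<gamma>"
    and unit: "norm u = 1" "norm v = 1" "norm w = 1"
    and orth: "u \<bullet> v = 0" "u \<bullet> w = 0" "v \<bullet> w = 0"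
  shows "(norm (x *\<^sub>R (\<gamma> u *v (\<gamma> v *v \<psi>)) + y *\<^sub>R (\<gamma> u *v (\<gamma> w *v \<psi>)) +
      z *\<^sub>R (\<gamma> v *v (\<gamma> w *v \<psi>))))\<^sup>2 = (x\<^sup>2 + y\<^sup>2 + z\<^sup>2) * (norm \<psi>)\<^sup>2"
proof -
  let ?p = "\<gamma> u *v (\<gamma> v *v \<psi>)" and ?q = "\<gamma> u *v (\<gamma> w *v \<psi>)" and ?r = "\<gamma> v *v (\<gamma> w *v \<psi>)"
  note inner = inner_clifford_mult_vectors[OF \<gamma>] inner_clifford_mult_spinors[OF \<gamma>]
  have pq: "?p \<bullet> ?q = 0" using unit orth by (simp add: inner)
  have "?p = - (\<gamma> v *v (\<gamma> u *v \<psi>))" using clifford_mult_anticommute[OF \<gamma>] orth by blast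
  then have pr: "?p \<bullet> ?r = 0" using unit orth by (simp add: inner)
  have "?q = - (\<gamma> w *v (\<gamma> u *v \<psi>))" "?r = - (\<gamma> w *v (\<gamma> v *v \<psi>))"
    using clifford_mult_anticommute[OF \<gamma>] orth by blast+
  then have qr: "?q \<bullet> ?r = 0" using unit orth by (simp add: inner)
  have sq: "?p \<bullet> ?p = (norm \<psi>)\<^sup>2" "?q \<bullet> ?q = (norm \<psi>)\<^sup>2" "?r \<bullet> ?r = (norm \<psi>)\<^sup>2"
    using unit by (simp_all add: dot_square_norm norm_clifford_mult[OF \<gamma>])
  show ?thesis
    unfolding power2_norm_eq_inner[of "x *\<^sub>R ?p + y *\<^sub>R ?q + z *\<^sub>R ?r"]
    by (simp add: inner_add_left inner_add_right sq pq pr qr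
        inner_commute[of ?q ?p] inner_commute[of ?r ?p] inner_commute[of ?r ?q])
      (simp add: algebra_simps power2_eq_square)
qed

section \<open>Unit representatives of a universal spinor field\<close>

lemma norm_clifford_spin:
  assumes "clifford_mult \<gamma>" and "s \<in> clifford_spin \<gamma>"
  shows "norm (s *v \<psi>) = norm \<psi>"
  using assms(2)
  by induction
    (simp_all add: matrix_vector_mul_assoc[symmetric] norm_clifford_mult[OF assms(1)])

lemma spin_rep_one:
  assumes "equivariant_spin_structure D"
  shows "\<one>\<^bsub>cover_grp D\<^esub> \<in> spin (cover D)" and "spin_rep D \<one>\<^bsub>cover_grp D\<^esub> *v \<psi> = \<psi>"
proof -
  let ?e = "\<one>\<^bsub>cover_grp D\<^esub>" and ?p = "cover D" and ?\<rho> = "spin_rep D"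
  have grp: "group (cover_grp D)" and hom: "\<And>b c. ?p (b \<otimes>\<^bsub>cover_grp D\<^esub> c) = ?p b ** ?p c"
    and cov: "covering_space UNIV ?p {A. det A > 0}" and \<gamma>: "clifford_mult (cliff D)"
    and \<rho>: "spin_representation (cover_grp D) ?p (cliff D) ?\<rho>"
    using assms by (simp_all add: equivariant_spin_structure_def connected_double_cover_def)
  interpret group "cover_grp D" by (rule grp)
  have ee: "?e \<otimes>\<^bsub>cover_grp D\<^esub> ?e = ?e" by simp
  have "det (?p ?e) > 0" using covering_space_imp_surjective[OF cov] by blast
  then have "invertible (?p ?e)" by (simp add: invertible_det_nz)
  moreover have idem: "?p ?e ** ?p ?e = ?p ?e" using hom[of ?e ?e] ee by simp
  ultimately have "?p ?e = mat 1"
    by (metis invertible_def matrix_mul_assoc matrix_mul_lid)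
  then show spin: "?e \<in> spin ?p"
    by (simp add: spin_def rotation_matrix_def orthogonal_matrix_id)
  have "?\<rho> ?e \<in> clifford_spin (cliff D)" and "?\<rho> ?e ** ?\<rho> ?e = ?\<rho> ?e"
    using \<rho> spin ee unfolding spin_representation_def by (metis bij_betwE)+
  \<comment> \<open>An idempotent that preserves norms is the identity.\<close>
  then have "norm (?\<rho> ?e *v \<psi> - \<psi>) = norm (?\<rho> ?e *v (?\<rho> ?e *v \<psi> - \<psi>))"
    and "?\<rho> ?e *v (?\<rho> ?e *v \<psi> - \<psi>) = 0"
    using norm_clifford_spin[OF \<gamma>]
    by metis (simp add: \<open>?\<rho> ?e ** ?\<rho> ?e = ?\<rho> ?e\<close> matrix_vector_mult_diff_distrib
        matrix_vector_mul_assoc)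
  then show "?\<rho> ?e *v \<psi> = \<psi>" by (metis norm_eq_zero eq_iff_diff_eq_0)
qed

text \<open>
  The spin representation is isometric, so having unit length depends on the class alone: every
  representative of an element of \<^const>\<open>N_inv\<close> has it.
\<close>

lemma norm_eq_1_of_N_inv:
  assumes D: "equivariant_spin_structure D" and N: "uspinor D a \<phi> \<in> N_inv D"
  shows "norm \<phi> = 1"
proof -
  have "group (cover_grp D)" "carrier (cover_grp D) = UNIV" and \<gamma>: "clifford_mult (cliff D)"
    and \<rho>: "spin_representation (cover_grp D) (cover D) (cliff D) (spin_rep D)"
    using D by (simp_all add: equivariant_spin_structure_def connected_double_cover_def)
  then have "a = a \<otimes>\<^bsub>cover_grp D\<^esub> \<one>\<^bsub>cover_grp D\<^esub>" by (simp add: group.is_monoid monoid.r_one)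
  then have self: "(a, \<phi>) \<in> uspinor D a \<phi>"
    using spin_rep_one[OF D] unfolding uspinor_def by blast
  obtain a' \<phi>' where "uspinor D a \<phi> = uspinor D a' \<phi>'" and \<phi>': "norm \<phi>' = 1"
    using N unfolding N_inv_def by blast
  then obtain b where b: "b \<in> spin (cover D)" and b': "spin_rep D b *v \<phi> = \<phi>'"
    using self unfolding uspinor_def by auto
  have "spin_rep D b \<in> clifford_spin (cliff D)"
    using \<rho> b by (auto simp: spin_representation_def bij_betw_def)
  then show ?thesis using norm_clifford_spin[OF \<gamma>] b' \<phi>' by metis
qed

section \<open>The spinorial energy\<close>

lemma energy_eq:
  assumes "equivariant_spin_structure D"
  shows "energy D a \<phi> = 1 / (32 * det (cover D a)) *
    (\<Sum>i\<in>UNIV. (struct_c D i 1 2 (cover D a))\<^sup>2 + (struct_c D i 1 3 (cover D a))\<^sup>2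
             + (struct_c D i 2 3 (cover D a))\<^sup>2) * (norm \<phi>)\<^sup>2"
proof -
  have \<gamma>: "clifford_mult (cliff D)"
    using assms by (simp add: equivariant_spin_structure_def)
  let ?c = "\<lambda>i j k. struct_c D i j k (cover D a)" and ?E = "\<lambda>j. cliff D (axis j 1)"
  have "(norm (\<Sum>(j, k)\<in>{(1, 2), (1, 3), (2, 3)}. ?c i j k *\<^sub>R (?E j *v (?E k *v \<phi>))))\<^sup>2 =
      ((?c i 1 2)\<^sup>2 + (?c i 1 3)\<^sup>2 + (?c i 2 3)\<^sup>2) * (norm \<phi>)\<^sup>2" for i
    using norm_clifford_two_vectors[OF \<gamma>, of "axis 1 1" "axis 2 1" "axis 3 1"
        "?c i 1 2" \<phi> "?c i 1 3" "?c i 2 3"]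
    by (simp add: inner_axis_axis add.assoc)
  then show ?thesis
    unfolding energy_def Let_def by (simp only: sum_distrib_right[symmetric] mult.assoc)
qed

text \<open>
  For \<open>\<phi>\<close> orthogonal to \<open>\<phi>'\<close> the energy at \<open>\<phi> + t \<phi>'\<close> is an affine function of \<open>t\<^sup>2\<close>, hence stationary
  at \<open>t = 0\<close>.
\<close>

lemma Q2_eq_0:
  assumes D: "equivariant_spin_structure D"
  shows "Q2 D a \<phi> = 0"
proof -
  have deriv: "deriv (\<lambda>t. energy D a (\<phi> + t *\<^sub>R \<phi>')) 0 = 0" if "\<phi> \<bullet> \<phi>' = 0" for \<phi>'
  proof -
    obtain c where "\<And>\<psi>. energy D a \<psi> = c * (norm \<psi>)\<^sup>2" using energy_eq[OF D] by blast
    then have "energy D a (\<phi> + t *\<^sub>R \<phi>') = c * ((norm \<phi>)\<^sup>2 + t\<^sup>2 * (norm \<phi>')\<^sup>2)" for t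
      using that by (simp add: norm_add_Pythagorean orthogonal_def power_mult_distrib)
    moreover have "((\<lambda>t. c * ((norm \<phi>)\<^sup>2 + t\<^sup>2 * (norm \<phi>')\<^sup>2)) has_field_derivative 0) (at 0)"
      by (auto intro!: derivative_eq_intros)
    ultimately show ?thesis by (simp add: DERIV_imp_deriv)
  qed
  have "q = 0" if "q \<in> perp_inv D a \<phi>" "\<forall>\<phi>'\<in>perp_inv D a \<phi>. q \<bullet> \<phi>' = 0" for q
    using that inner_eq_zero_iff by blast
  moreover have "0 \<in> perp_inv D a \<phi>" by (simp add: perp_inv_def)
  moreover have "deriv (\<lambda>t. energy D a (\<phi> + t *\<^sub>R \<phi>')) 0 = 0" if "\<phi>' \<in> perp_inv D a \<phi>" for \<phi>'
    using that deriv by (simp add: perp_inv_def)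
  ultimately show ?thesis unfolding Q2_def by (intro the_equality) auto
qed

section \<open>Constancy of the spinor along the flow\<close>

lemma flow_solution_constant_spinor:
  assumes sol: "flow_solution D \<W> R1 R2 I a \<phi> \<Phi>"
    and R2: "\<And>b \<psi>. R2 b \<psi> = 0"
  shows "\<exists>a'. horizontal_curve D I a' \<and> a' 0 = a \<and>
    (\<forall>t\<in>I. \<Phi> t = uspinor D (a' t) \<phi> \<and> uspinor D (a' t) \<phi> \<in> \<W>)"
proof -
  obtain g a' \<phi>' where I: "is_interval I" "0 \<in> I" and init: "a' 0 = a" "\<phi>' 0 = \<phi>"
    and lift: "horizontal_lift D I g a'"
    and \<Phi>: "\<And>t. t \<in> I \<Longrightarrow> \<Phi> t = uspinor D (a' t) (\<phi>' t) \<and> \<Phi> t \<in> \<W>"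
    and ode: "\<And>t. t \<in> I \<Longrightarrow> (\<phi>' has_vector_derivative R2 (a' t) (\<phi>' t)) (at t within I)"
    using sol unfolding flow_solution_def by metis
  have "\<phi>' t = \<phi>" if t: "t \<in> I" for t
  proof -
    have "convex I" using I(1) by (rule is_interval_convex)
    moreover have "(\<phi>' has_vector_derivative 0) (at s within I)" if "s \<in> I" for s
      using ode[OF that] by (simp add: R2)
    ultimately obtain c where "\<And>s. s \<in> I \<Longrightarrow> \<phi>' s = c"
      using has_vector_derivative_zero_constant by metis
    then show ?thesis using I(2) init(2) t by metis
  qed
  then show ?thesis using lift \<Phi> init(1) unfolding horizontal_lift_def by metis
qed

theorem theorem5p1:
  fixes D :: "('g::{t2_space,second_countable_topology}, 'e::euclidean_space,
      'm::{t2_space,second_countable_topology}, 'l::topological_space) homogeneous"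
    and a :: 'l and \<phi> :: spinor
  assumes "reductive_homogeneous_spin_manifold D"
    and "uspinor D a \<phi> \<in> N_inv D"
  shows "energy D a \<phi> = 1 / (32 * det (cover D a)) *
           (\<Sum>i\<in>UNIV. (struct_c D i 1 2 (cover D a))\<^sup>2 + (struct_c D i 1 3 (cover D a))\<^sup>2
                    + (struct_c D i 2 3 (cover D a))\<^sup>2) \<and>
         Q2 D a \<phi> = 0 \<and>
         (\<forall>I \<Phi>. spinor_flow_solution D I a \<phi> \<Phi> \<longrightarrow>
            (\<exists>a'. horizontal_curve D I a' \<and> a' 0 = a \<and>
                  (\<forall>t\<in>I. \<Phi> t = uspinor D (a' t) \<phi> \<and> uspinor D (a' t) \<phi> \<in> N_inv D))) \<and>
         (uspinor D a \<phi> \<in> N1_inv D \<longrightarrow>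
          (\<forall>I \<Phi>. normalized_flow_solution D I a \<phi> \<Phi> \<longrightarrow>
            (\<exists>a'. horizontal_curve D I a' \<and> a' 0 = a \<and>
                  (\<forall>t\<in>I. \<Phi> t = uspinor D (a' t) \<phi> \<and> uspinor D (a' t) \<phi> \<in> N1_inv D))))"
proof -
  have D: "equivariant_spin_structure D"
    using assms(1) by (simp add: reductive_homogeneous_spin_manifold_def)
  have norm: "norm \<phi> = 1" using D assms(2) by (rule norm_eq_1_of_N_inv)
  note constant_spinor = flow_solution_constant_spinor[of D _ _ _ _ a \<phi>]
  show ?thesis
    unfolding energy_eq[OF D] spinor_flow_solution_def normalized_flow_solution_def
    by (auto simp: norm Q2_eq_0[OF D] Q2_norm_def intro!: constant_spinor)
qed

end
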